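(* The image of $P_n$ under the truncated-coordinate map $p\mapsto\big(p_2-\binom{n}{2},\,p_3-\binom{n}{3},\dots,\,p_n-\binom{n}{n}\big)\in\mathbb{R}^{n-1}$ is a reflexive lattice polytope.
   Context: Let $\Omega$ be the $n\times n$ matrix with $(i,j)$-entry $j\binom{i+1}{j+1}$, and let $P_n\subseteq\mathbb{R}^n$ be the convex hull of the rows of $\Omega$; points of $\mathbb{R}^n$ are written $p=(p_1,\dots,p_n)$. For an $(n-1)$-dimensional simplex $P\subseteq\mathbb{R}^{n-1}$ with vertices $v_1,\dots,v_n$ and containing $0$ in its interior, its dual $P^\ast$ is the simplex with vertices $y_1,\dots,y_n$ determined by $\langle v_i,y_j\rangle=-1$ for all $i\neq j$ (equivalently $P^\ast=\{y:\langle x,y\rangle\ge-1\ \forall x\in P\}$). A lattice polytope $P$ is reflexive if it contains $0$ as an interior point and $P^\ast$ is also a lattice polytope (vertices in $\mathbb{Z}^{n-1}$). *)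

theory Defs
  imports "HOL-Analysis.Analysis" "HOL-Analysis.Finite_Function_Topology"
begin

text \<open>
  Both \<open>\<real>\<^sup>n\<close> and \<open>\<real>\<^sup>n\<^sup>-\<^sup>1\<close> occur for one variable \<open>n\<close>, so \<open>\<real>\<^sup>d\<close> is the subspace of
  finitely supported functions with support in \<open>{1..d}\<close>, coordinates numbered from 1.
  Addition, scaling and norm (the sum of the absolute values of the coordinates, hence the
  usual topology on each \<open>\<real>\<^sup>d\<close>) are those of the library type; \<open>\<real>\<^sup>0\<close> is a point.
\<close>

definition coord_space :: "nat \<Rightarrow> (nat \<Rightarrow>\<^sub>0 real) set" where
  "coord_space d = {x. Poly_Mapping.keys x \<subseteq> {1..d}}"

definition coord_vec :: "nat \<Rightarrow> (nat \<Rightarrow> real) \<Rightarrow> (nat \<Rightarrow>\<^sub>0 real)" where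
  "coord_vec d f = Abs_poly_mapping (\<lambda>j. if j \<in> {1..d} then f j else 0)"

lemma lookup_coord_vec:
  "Poly_Mapping.lookup (coord_vec d f) j = (if j \<in> {1..d} then f j else 0)"
proof -
  have "finite {j. (if j \<in> {1..d} then f j else 0) \<noteq> 0}"
    by (rule finite_subset[of _ "{1..d}"]) auto
  then show ?thesis
    by (simp add: coord_vec_def)
qed

lemma coord_vec_in_coord_space: "coord_vec d f \<in> coord_space d"
  by (auto simp: coord_space_def in_keys_iff lookup_coord_vec split: if_splits)

definition coord_inner :: "nat \<Rightarrow> (nat \<Rightarrow>\<^sub>0 real) \<Rightarrow> (nat \<Rightarrow>\<^sub>0 real) \<Rightarrow> real" where
  "coord_inner d x y = (\<Sum>j = 1..d. Poly_Mapping.lookup x j * Poly_Mapping.lookup y j)"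

definition int_lattice :: "nat \<Rightarrow> (nat \<Rightarrow>\<^sub>0 real) set" where
  "int_lattice d = {x \<in> coord_space d. \<forall>j. Poly_Mapping.lookup x j \<in> \<int>}"

definition lattice_polytope :: "nat \<Rightarrow> (nat \<Rightarrow>\<^sub>0 real) set \<Rightarrow> bool" where
  "lattice_polytope d P \<longleftrightarrow>
     P \<subseteq> coord_space d \<and> polytope P \<and> (\<forall>v. v extreme_point_of P \<longrightarrow> v \<in> int_lattice d)"

definition dual_polytope :: "nat \<Rightarrow> (nat \<Rightarrow>\<^sub>0 real) set \<Rightarrow> (nat \<Rightarrow>\<^sub>0 real) set" where
  "dual_polytope d P = {y \<in> coord_space d. \<forall>x \<in> P. coord_inner d x y \<ge> -1}"

text \<open>
  The interior is taken in \<open>\<real>\<^sup>d\<close>, not in the affine hull of the polytope and not in the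
  infinite-dimensional ambient type.
\<close>

definition reflexive_polytope :: "nat \<Rightarrow> (nat \<Rightarrow>\<^sub>0 real) set \<Rightarrow> bool" where
  "reflexive_polytope d P \<longleftrightarrow>
     lattice_polytope d P \<and>
     0 \<in> (top_of_set (coord_space d)) interior_of P \<and>
     lattice_polytope d (dual_polytope d P)"

definition Omega :: "nat \<Rightarrow> nat \<Rightarrow> nat" where
  "Omega i j = j * ((i + 1) choose (j + 1))"

definition Omega_row :: "nat \<Rightarrow> nat \<Rightarrow> (nat \<Rightarrow>\<^sub>0 real)" where
  "Omega_row n i = coord_vec n (\<lambda>j. real (Omega i j))"

definition Omega_polytope :: "nat \<Rightarrow> (nat \<Rightarrow>\<^sub>0 real) set" where
  "Omega_polytope n = convex hull (Omega_row n ` {1..n})"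

text \<open>The \<open>k\<close>-th coordinate of the image is \<open>p\<^sub>k\<^sub>+\<^sub>1\<close> minus \<open>n choose (k + 1)\<close>, for \<open>k = 1, \<dots>, n - 1\<close>.\<close>

definition trunc_shift :: "nat \<Rightarrow> (nat \<Rightarrow>\<^sub>0 real) \<Rightarrow> (nat \<Rightarrow>\<^sub>0 real)" where
  "trunc_shift n p =
     coord_vec (n - 1) (\<lambda>k. Poly_Mapping.lookup p (k + 1) - real (n choose (k + 1)))"

end

theory Submission
  imports Defs
begin

text \<open>
  Identify \<open>p\<close> with the polynomial \<open>\<Sum>\<^sub>j p\<^sub>j x\<^sup>j\<^sup>-\<^sup>1\<close> and expand it in powers of \<open>y = 1 + x\<close>, a unimodular
  change of coordinates. Row \<open>i\<close> of \<open>\<Omega>\<close> becomes \<open>1 + 2y + \<dots> + i y\<^sup>i\<^sup>-\<^sup>1\<close> and the vector of binomial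
  coefficients \<open>n choose j\<close> becomes \<open>1 + y + \<dots> + y\<^sup>n\<^sup>-\<^sup>1\<close>. Modulo constants the shifted simplex thus has
  vertices with coordinates \<open>z\<^sub>a = (a + 1)[a < i] - 1\<close>, \<open>1 \<le> a < n\<close>, and its facets are
  \<open>1 \<ge> (z\<^sub>1 + 1)/2 \<ge> (z\<^sub>2 + 1)/3 \<ge> \<dots> \<ge> (z\<^sub>n\<^sub>-\<^sub>1 + 1)/n \<ge> 0\<close>. Clearing denominators turns them into
  \<open>-z\<^sub>1 \<ge> -1\<close>, \<open>(a + 2)z\<^sub>a - (a + 1)z\<^sub>a\<^sub>+\<^sub>1 \<ge> -1\<close> and \<open>z\<^sub>n\<^sub>-\<^sub>1 \<ge> -1\<close>, so the dual vertices are integral.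
\<close>

section \<open>Linear structure of the coordinate spaces\<close>

lemma lookup_scaleR: "Poly_Mapping.lookup (r *\<^sub>R x) j = r *\<^sub>R Poly_Mapping.lookup x j"
proof -
  have "finite {i. r *\<^sub>R Poly_Mapping.lookup x i \<noteq> 0}"
    by (rule finite_subset[OF _ finite_keys[of x]]) (auto simp: in_keys_iff)
  then show ?thesis
    by (simp add: scaleR_poly_mapping_def)
qed

lemma coord_space_iff: "x \<in> coord_space d \<longleftrightarrow> (\<forall>j. j \<notin> {1..d} \<longrightarrow> Poly_Mapping.lookup x j = 0)"
  by (auto simp: coord_space_def in_keys_iff subset_iff)

lemma subspace_coord_space: "subspace (coord_space d)"
  by (auto simp: subspace_def coord_space_iff lookup_add lookup_scaleR)

lemma coord_inner_commute: "coord_inner d x y = coord_inner d y x"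
  by (simp add: coord_inner_def mult.commute)

lemma linear_coord_inner: "linear (coord_inner d x)"
  by (rule linearI)
    (simp_all add: coord_inner_def lookup_add lookup_scaleR algebra_simps sum.distrib sum_distrib_left)

lemma linear_coord_inner_left: "linear (\<lambda>x. coord_inner d x y)"
  using linear_coord_inner[of d y] by (subst coord_inner_commute)

lemma abs_lookup_le_norm: "\<bar>Poly_Mapping.lookup x j\<bar> \<le> norm (x :: nat \<Rightarrow>\<^sub>0 real)"
proof (cases "j \<in> Poly_Mapping.keys x")
  case True
  then have "\<bar>Poly_Mapping.lookup x j\<bar> \<le> (\<Sum>i\<in>Poly_Mapping.keys x. \<bar>Poly_Mapping.lookup x i\<bar>)"
    by (intro member_le_sum) auto
  then show ?thesis
    by (simp add: norm_poly_mapping_def dist_poly_mapping_def)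
qed (simp add: in_keys_iff)

lemma continuous_on_lookup: "continuous_on S (\<lambda>x::nat \<Rightarrow>\<^sub>0 real. Poly_Mapping.lookup x j)"
proof -
  have "bounded_linear (\<lambda>x::nat \<Rightarrow>\<^sub>0 real. Poly_Mapping.lookup x j)"
    by (rule bounded_linear_intro[where K = 1])
      (simp_all add: lookup_add lookup_scaleR abs_lookup_le_norm)
  then show ?thesis
    by (rule linear_continuous_on)
qed

lemma continuous_on_coord_inner_left: "continuous_on S (\<lambda>x. coord_inner d x y)"
  unfolding coord_inner_def by (intro continuous_intros continuous_on_lookup)

section \<open>Duals of simplices\<close>

text \<open>Each \<open>y\<close> defines a half-space in \<open>x\<close>, which is convex and so
  contains the hull once it contains \<open>S\<close>. The dual is thus cut out by one inequality
  per vertex.\<close>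

lemma dual_polytope_convex_hull:
  "dual_polytope d (convex hull S) = {y \<in> coord_space d. \<forall>x\<in>S. coord_inner d x y \<ge> -1}"
proof -
  have "coord_inner d x y \<ge> -1"
    if "\<forall>x\<in>S. coord_inner d x y \<ge> -1" "x \<in> convex hull S" for x y
  proof -
    have "convex ((\<lambda>x. coord_inner d x y) -` {-1..})"
      by (intro convex_linear_vimage linear_coord_inner_left) simp
    moreover have "S \<subseteq> (\<lambda>x. coord_inner d x y) -` {-1..}"
      using that by auto
    ultimately show ?thesis
      using hull_minimal[of S _ convex] that by blast
  qed
  then show ?thesis
    by (auto simp: dual_polytope_def intro: hull_inc)
qed

lemma lattice_polytope_convex_hull:
  assumes "finite S" "S \<subseteq> int_lattice d"
  shows "lattice_polytope d (convex hull S)"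
proof -
  have "S \<subseteq> coord_space d"
    using assms by (auto simp: int_lattice_def)
  then have "convex hull S \<subseteq> coord_space d"
    by (intro hull_minimal subspace_imp_convex subspace_coord_space)
  moreover have "polytope (convex hull S)"
    using assms by (auto simp: polytope_def)
  ultimately show ?thesis
    using assms extreme_point_of_convex_hull by (auto simp: lattice_polytope_def)
qed

text \<open>The strict versions of the finitely many defining inequalities cut out an open set
  around the origin. A polytope that is itself a dual therefore has 0 in its interior.\<close>

lemma zero_in_interior_dual_polytope:
  assumes "finite S"
  shows "0 \<in> top_of_set (coord_space d) interior_of dual_polytope d (convex hull S)"
proof -
  let ?U = "\<Inter>x\<in>S. {y. coord_inner d y x > -1}"
  have "open ?U"
    using assms by (intro open_INT ballI open_Collect_less continuous_on_const
        continuous_on_coord_inner_left) auto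
  then have "openin (top_of_set (coord_space d)) (coord_space d \<inter> ?U)"
    by (rule openin_open_Int)
  moreover have "0 \<in> coord_space d \<inter> ?U"
    using subspace_0[OF subspace_coord_space] linear_0[OF linear_coord_inner_left] by auto
  moreover have "coord_space d \<inter> ?U \<subseteq> dual_polytope d (convex hull S)"
    unfolding dual_polytope_convex_hull
    by (force simp: coord_inner_commute[of d] intro: less_imp_le)
  ultimately show ?thesis
    unfolding interior_of_def by blast
qed

text \<open>
  The numbers \<open>1 / c i\<close> are the barycentric coordinates of the origin in both simplices.
\<close>

lemma dual_polytope_simplex:
  fixes w y :: "'a \<Rightarrow> nat \<Rightarrow>\<^sub>0 real" and c :: "'a \<Rightarrow> real"
  assumes fin: "finite I"
    and w: "\<And>i. i \<in> I \<Longrightarrow> w i \<in> coord_space d"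
    and y: "\<And>i. i \<in> I \<Longrightarrow> y i \<in> coord_space d"
    and c: "\<And>i. i \<in> I \<Longrightarrow> c i > 0" "(\<Sum>i\<in>I. 1 / c i) = 1"
    and pairing: "\<And>i j. i \<in> I \<Longrightarrow> j \<in> I \<Longrightarrow>
      coord_inner d (w i) (y j) = (if i = j then c i else 0) - 1"
    and sep_w: "\<And>u. u \<in> coord_space d \<Longrightarrow> (\<And>i. i \<in> I \<Longrightarrow> coord_inner d (w i) u = 0) \<Longrightarrow> u = 0"
    and sep_y: "\<And>u. u \<in> coord_space d \<Longrightarrow> (\<And>i. i \<in> I \<Longrightarrow> coord_inner d u (y i) = 0) \<Longrightarrow> u = 0"
  shows "dual_polytope d (convex hull (w ` I)) = convex hull (y ` I)"
proof
  show "convex hull (y ` I) \<subseteq> dual_polytope d (convex hull (w ` I))"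
  proof (rule hull_minimal)
    have "convex (coord_space d \<inter> (\<Inter>i\<in>I. coord_inner d (w i) -` {-1..}))"
      by (intro convex_Int convex_INT convex_linear_vimage linear_coord_inner
          subspace_imp_convex[OF subspace_coord_space]) simp
    moreover have "dual_polytope d (convex hull (w ` I)) =
        coord_space d \<inter> (\<Inter>i\<in>I. coord_inner d (w i) -` {-1..})"
      by (auto simp: dual_polytope_convex_hull)
    ultimately show "convex (dual_polytope d (convex hull (w ` I)))"
      by simp
    show "y ` I \<subseteq> dual_polytope d (convex hull (w ` I))"
      using y c(1) by (auto simp: dual_polytope_convex_hull pairing less_imp_le)
  qed
next
  have pick: "(\<Sum>i\<in>I. f i * (if i = j then a i else 0)) = f j * a j" if "j \<in> I" for f a :: "'a \<Rightarrow> real" and j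
    using fin that by (simp add: if_distrib[of "\<lambda>x. _ * x"] sum.delta cong: if_cong)
  \<comment> \<open>The combination pairs with each \<open>y j\<close> to 1 - 1: the diagonal term
    gives 1, the constants -1 sum to -1.\<close>
  have barycenter: "(\<Sum>i\<in>I. (1 / c i) *\<^sub>R w i) = 0"
  proof (rule sep_y)
    show "(\<Sum>i\<in>I. (1 / c i) *\<^sub>R w i) \<in> coord_space d"
      using w by (intro subspace_sum subspace_mul subspace_coord_space) auto
    show "coord_inner d (\<Sum>i\<in>I. (1 / c i) *\<^sub>R w i) (y j) = 0" if "j \<in> I" for j
    proof -
      have "coord_inner d (\<Sum>i\<in>I. (1 / c i) *\<^sub>R w i) (y j) =
          (\<Sum>i\<in>I. 1 / c i * ((if i = j then c i else 0) - 1))"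
        using that by (simp add: linear_sum[OF linear_coord_inner_left]
            linear_scale[OF linear_coord_inner_left] pairing)
      also have "\<dots> = 0"
        using that c pick[OF that, of "\<lambda>i. 1 / c i" c] less_imp_neq[OF c(1)[OF that]]
        by (simp add: right_diff_distrib sum_subtractf)
      finally show ?thesis .
    qed
  qed
  show "dual_polytope d (convex hull (w ` I)) \<subseteq> convex hull (y ` I)"
  proof
    fix z assume "z \<in> dual_polytope d (convex hull (w ` I))"
    then have z: "z \<in> coord_space d" and zw: "\<And>i. i \<in> I \<Longrightarrow> coord_inner d (w i) z \<ge> -1"
      by (auto simp: dual_polytope_convex_hull)
    \<comment> \<open>Candidate barycentric coordinates of \<open>z\<close>: if \<open>z\<close> is
      the combination of the \<open>y j\<close> with weights \<open>m j\<close> of sum 1, its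
      pairing with \<open>w i\<close> is \<open>m i * c i - 1\<close>; solve for
      \<open>m i\<close>.\<close>
    define m where "m i = (coord_inner d (w i) z + 1) / c i" for i
    have "(\<Sum>i\<in>I. 1 / c i * coord_inner d (w i) z) = coord_inner d (\<Sum>i\<in>I. (1 / c i) *\<^sub>R w i) z"
      by (simp add: linear_sum[OF linear_coord_inner_left] linear_scale[OF linear_coord_inner_left])
    also have "\<dots> = 0"
      by (simp add: barycenter linear_0[OF linear_coord_inner_left])
    finally have m_sum: "(\<Sum>i\<in>I. m i) = 1"
      using c(2) by (simp add: m_def add_divide_distrib sum.distrib)
    \<comment> \<open>Both points have the same pairing with every \<open>w i\<close>, and these
      pairings separate points.\<close>
    have "z - (\<Sum>j\<in>I. m j *\<^sub>R y j) = 0"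
    proof (rule sep_w)
      show "z - (\<Sum>j\<in>I. m j *\<^sub>R y j) \<in> coord_space d"
        using z y by (intro subspace_diff subspace_sum subspace_mul subspace_coord_space) auto
      show "coord_inner d (w i) (z - (\<Sum>j\<in>I. m j *\<^sub>R y j)) = 0" if "i \<in> I" for i
      proof -
        have "coord_inner d (w i) (\<Sum>j\<in>I. m j *\<^sub>R y j) =
            (\<Sum>j\<in>I. m j * ((if j = i then c j else 0) - 1))"
          using that by (auto simp: linear_sum[OF linear_coord_inner]
              linear_scale[OF linear_coord_inner] pairing intro!: sum.cong)
        also have "\<dots> = m i * c i - 1"
          using pick[OF that, of m c] m_sum by (simp add: right_diff_distrib sum_subtractf)
        also have "\<dots> = coord_inner d (w i) z"
          using c(1)[OF that] by (simp add: m_def)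
        finally show ?thesis
          by (simp add: linear_diff[OF linear_coord_inner])
      qed
    qed
    moreover have "(\<Sum>j\<in>I. m j *\<^sub>R y j) \<in> convex hull (y ` I)"
    proof (intro convex_sum)
      show "m i \<ge> 0" if "i \<in> I" for i
        unfolding m_def using zw[OF that] c(1)[OF that] by (intro divide_nonneg_pos) simp_all
    qed (use fin m_sum in \<open>auto simp: hull_inc\<close>)
    ultimately show "z \<in> convex hull (y ` I)"
      by simp
  qed
qed

section \<open>Binomial identities\<close>

text \<open>Compares coefficients of \<open>x^k\<close> in \<open>1 + y + ... + y^(n-1)\<close> with
  \<open>y = 1 + x\<close>.\<close>

lemma sum_choose_upper_lessThan: "(\<Sum>a<n. a choose k) = n choose Suc k"
  by (induction n) auto

text \<open>Absorption turns \<open>Suc a * (a choose k)\<close> into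
  \<open>Suc k * (Suc a choose Suc k)\<close>, and summing over the upper index gives the entry of
  \<open>Omega\<close>.\<close>

lemma Omega_Suc_eq_sum: "Omega i (Suc k) = (\<Sum>a<i. Suc a * (a choose k))"
proof -
  have "Suc k * (\<Sum>a<i. Suc a choose Suc k) = Omega i (Suc k)"
    unfolding Omega_def by (induction i) (auto simp: algebra_simps)
  then show ?thesis
    unfolding sum_distrib_left Suc_times_binomial by (rule sym)
qed

text \<open>The change of basis between powers of \<open>1 + x\<close> and powers of
  \<open>x\<close>, composed with its inverse. Since \<open>b \<ge> 1\<close>, the term
  \<open>k = 0\<close> would vanish, so the sum may start at 1.\<close>

lemma binomial_inversion:
  assumes "a \<le> d" "b \<ge> 1"
  shows "(\<Sum>k = 1..d. real (a choose k) * ((-1) ^ (k + b) * real (k choose b))) = (if a = b then 1 else 0)"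
proof (cases "b \<le> a")
  case False
  have "(a choose k) = 0 \<or> (k choose b) = 0" for k
    using False by (cases "k \<le> a") (auto simp: binomial_eq_0)
  then show ?thesis
    using False by (auto intro!: sum.neutral)
next
  case True
  have "(\<Sum>k = 1..d. real (a choose k) * ((-1) ^ (k + b) * real (k choose b)))
      = (\<Sum>k = b..a. real (a choose k) * ((-1) ^ (k + b) * real (k choose b)))"
    using assms by (intro sum.mono_neutral_right) (auto simp: not_le binomial_eq_0)
  also have "\<dots> = (\<Sum>k = b..a. (-1) ^ (k - b) * real (a choose b) * real ((a - b) choose (k - b)))"
  proof (rule sum.cong[OF refl])
    fix k assume k: "k \<in> {b..a}"
    \<comment> \<open>Trinomial revision takes \<open>a choose b\<close> out of the sum and leaves
      an alternating sum of binomials, \<open>(1 - 1)^(a - b)\<close>.\<close>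
    then have "real (a choose k) * real (k choose b) = real (a choose b) * real ((a - b) choose (k - b))"
      using choose_mult[of b k a] by (simp flip: of_nat_mult)
    moreover have "(-1::real) ^ (k + b) = (-1) ^ (k - b)"
      using k by (simp add: minus_one_power_iff)
    ultimately show "real (a choose k) * ((-1) ^ (k + b) * real (k choose b)) =
        (-1) ^ (k - b) * real (a choose b) * real ((a - b) choose (k - b))"
      by simp
  qed
  also have "\<dots> = (\<Sum>i\<le>a - b. (-1) ^ i * real (a choose b) * real ((a - b) choose i))"
    using True by (intro sum.reindex_bij_witness[of _ "\<lambda>i. i + b" "\<lambda>k. k - b"]) auto
  also have "\<dots> = real (a choose b) * (\<Sum>i\<le>a - b. (-1) ^ i * real ((a - b) choose i))"
    by (simp add: sum_distrib_left mult_ac)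
  also have "\<dots> = (if a = b then 1 else 0)"
    using True choose_alternating_sum[of "a - b", where 'a = real] by auto
  finally show ?thesis .
qed

section \<open>The shifted simplex and its dual\<close>

definition shifted_row :: "nat \<Rightarrow> nat \<Rightarrow> nat \<Rightarrow>\<^sub>0 real" where
  "shifted_row n i = trunc_shift n (Omega_row n i)"

text \<open>
  Pairing with \<open>coeff_functional d a\<close> extracts the coefficient of \<open>(1 + x) ^ a\<close> from the
  polynomial with coefficients \<open>p\<^sub>k\<close>, \<open>k \<ge> 1\<close>; index \<open>0\<close> stands for the coordinate
  removed by the projection.
\<close>

definition coeff_functional :: "nat \<Rightarrow> nat \<Rightarrow> nat \<Rightarrow>\<^sub>0 real" where
  "coeff_functional d a = coord_vec d (\<lambda>k. if a = 0 then 0 else (-1) ^ (k + a) * real (k choose a))"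

text \<open>The inner normal of the facet opposite to row \<open>j\<close>. For
  \<open>j = 1 < n\<close> the functional of index 0 is zero, leaving the facet
  \<open>-z_1 \<ge> -1\<close>.\<close>

definition dual_vertex :: "nat \<Rightarrow> nat \<Rightarrow> nat \<Rightarrow>\<^sub>0 real" where
  "dual_vertex n j = (if j < n
     then real (j + 1) *\<^sub>R coeff_functional (n - 1) (j - 1) - real j *\<^sub>R coeff_functional (n - 1) j
     else coeff_functional (n - 1) (n - 1))"

text \<open>One more than the pairing of row \<open>j\<close> with its own dual vertex.\<close>

definition dual_scale :: "nat \<Rightarrow> nat \<Rightarrow> real" where
  "dual_scale n j = (if j < n then real j * real (j + 1) else real n)"

section \<open>Pairing of the vertices with the facet normals\<close>

lemma lookup_shifted_row:
  assumes "n \<ge> 1" "k \<in> {1..n - 1}"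
  shows "Poly_Mapping.lookup (shifted_row n i) k =
    real (Omega i (Suc k)) - real (n choose Suc k)"
  using assms by (auto simp: shifted_row_def trunc_shift_def Omega_row_def lookup_coord_vec)

lemma shifted_row_eq_sum:
  assumes "n \<ge> 1" "i \<le> n" "k \<in> {1..n - 1}"
  shows "Poly_Mapping.lookup (shifted_row n i) k =
    (\<Sum>a<n. (real (if a < i then Suc a else 0) - 1) * real (a choose k))"
proof -
  \<comment> \<open>Padding with zeros up to \<open>n\<close> gives both expansions the same index
    range.\<close>
  have "Omega i (Suc k) = (\<Sum>a<n. (if a < i then Suc a else 0) * (a choose k))"
    unfolding Omega_Suc_eq_sum using assms by (intro sum.mono_neutral_cong_left) auto
  then show ?thesis
    unfolding lookup_shifted_row[OF assms(1,3)] sum_choose_upper_lessThan[symmetric]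
    by (simp add: left_diff_distrib sum_subtractf)
qed

lemma coord_inner_shifted_row_coeff:
  assumes "n \<ge> 1" "i \<in> {1..n}" "b < n"
  shows "coord_inner (n - 1) (shifted_row n i) (coeff_functional (n - 1) b) =
    real (if b < i then Suc b else 0) - 1"
proof (cases "b = 0")
  \<comment> \<open>The functional of index 0 is zero by convention; this agrees with the formula
    because every row has \<open>i \<ge> 1\<close>, so its constant coefficient in \<open>y\<close>
    is 1 - 1.\<close>
  case True
  then show ?thesis
    using assms by (simp add: coord_inner_def coeff_functional_def lookup_coord_vec)
next
  case False
  let ?z = "\<lambda>a. real (if a < i then Suc a else 0) - 1"
  let ?s = "\<lambda>k. (-1) ^ (k + b) * real (k choose b)"
  have "coord_inner (n - 1) (shifted_row n i) (coeff_functional (n - 1) b) =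
      (\<Sum>k = 1..n - 1. (\<Sum>a<n. ?z a * real (a choose k)) * ?s k)"
    unfolding coord_inner_def using assms False
    by (intro sum.cong) (auto simp: shifted_row_eq_sum coeff_functional_def lookup_coord_vec)
  also have "\<dots> = (\<Sum>a<n. ?z a * (\<Sum>k = 1..n - 1. real (a choose k) * ?s k))"
    by (subst sum_distrib_right, subst sum.swap) (simp add: sum_distrib_left mult.assoc)
  also have "\<dots> = (\<Sum>a<n. ?z a * (if a = b then 1 else 0))"
    using False by (intro sum.cong refl) (subst binomial_inversion, auto)
  also have "\<dots> = ?z b"
    using assms by (simp add: if_distrib[of "\<lambda>x. _ * x"] cong: if_cong)
  finally show ?thesis .
qed

text \<open>For \<open>j < n\<close> the pairing is \<open>-(j+1) + j\<close> if
  \<open>i < j\<close>, \<open>(j+1)(j-1) - j^2\<close> if \<open>i > j\<close>, and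
  \<open>(j+1)(j-1) + j\<close> if \<open>i = j\<close>.\<close>

lemma coord_inner_shifted_row_dual_vertex:
  assumes "i \<in> {1..n}" "j \<in> {1..n}"
  shows "coord_inner (n - 1) (shifted_row n i) (dual_vertex n j) =
    (if i = j then dual_scale n i else 0) - 1"
proof (cases "j < n")
  case True
  have "coord_inner (n - 1) (shifted_row n i) (dual_vertex n j) =
      real (j + 1) * (real (if j - 1 < i then Suc (j - 1) else 0) - 1)
        - real j * (real (if j < i then Suc j else 0) - 1)"
    using True assms coord_inner_shifted_row_coeff[of n i "j - 1"] coord_inner_shifted_row_coeff[of n i j]
    by (simp add: dual_vertex_def linear_diff[OF linear_coord_inner]
        linear_scale[OF linear_coord_inner] del: of_nat_Suc)
  also have "\<dots> = (if i = j then dual_scale n i else 0) - 1"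
    using True assms by (auto simp: dual_scale_def algebra_simps)
  finally show ?thesis .
next
  case False
  then show ?thesis
    using assms coord_inner_shifted_row_coeff[of n i "n - 1"]
    by (auto simp: dual_vertex_def dual_scale_def)
qed

section \<open>Nondegeneracy of the pairing\<close>

text \<open>Rows \<open>m\<close> and \<open>Suc m\<close> differ by \<open>Suc m\<close> times row
  \<open>m\<close> of Pascal's triangle, which vanishes beyond index \<open>m\<close>. With
  \<open>m\<close> the least index in the support of \<open>u\<close>, only the term at
  \<open>m\<close> survives.\<close>

lemma shifted_row_separates:
  assumes "n \<ge> 1" "u \<in> coord_space (n - 1)"
    and zero: "\<And>i. i \<in> {1..n} \<Longrightarrow> coord_inner (n - 1) (shifted_row n i) u = 0"
  shows "u = 0"
proof (rule ccontr)
  let ?K = "Poly_Mapping.keys u"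
  assume "u \<noteq> 0"
  define m where "m = Min ?K"
  have m: "m \<in> ?K" "\<And>k. k \<in> ?K \<Longrightarrow> m \<le> k"
    using \<open>u \<noteq> 0\<close> by (auto simp: m_def)
  have md: "m \<in> {1..n - 1}"
    using m assms(2) by (auto simp: coord_space_def)
  have row_diff: "Poly_Mapping.lookup (shifted_row n (Suc m)) k - Poly_Mapping.lookup (shifted_row n m) k
      = real (Suc m * (m choose k))" if "k \<in> {1..n - 1}" for k
    unfolding lookup_shifted_row[OF assms(1) that] Omega_Suc_eq_sum by simp
  have "coord_inner (n - 1) (shifted_row n (Suc m)) u - coord_inner (n - 1) (shifted_row n m) u
      = (\<Sum>k = 1..n - 1. real (Suc m * (m choose k)) * Poly_Mapping.lookup u k)"
    unfolding coord_inner_def sum_subtractf[symmetric] left_diff_distrib[symmetric]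
    by (intro sum.cong refl) (simp only: row_diff)
  also have "\<dots> = (\<Sum>k\<in>{m}. real (Suc m * (m choose k)) * Poly_Mapping.lookup u k)"
  proof (intro sum.mono_neutral_right ballI)
    fix k assume "k \<in> {1..n - 1} - {m}"
    then have "k \<notin> ?K \<or> (m choose k) = 0"
      using m(2)[of k] by (auto simp: binomial_eq_0)
    then show "real (Suc m * (m choose k)) * Poly_Mapping.lookup u k = 0"
      by (metis in_keys_iff mult_zero_left mult_zero_right of_nat_0)
  qed (use md in auto)
  also have "\<dots> \<noteq> 0"
    using m by (auto simp: in_keys_iff)
  finally show False
    using zero[of m] zero[of "Suc m"] md assms(1) by auto
qed

text \<open>The dual vertices span the coefficient functionals, whose matrix is triangular:
  \<open>k choose m\<close> vanishes for \<open>k < m\<close>. With \<open>m\<close> the greatest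
  index in the support of \<open>u\<close>, only the term at \<open>m\<close> survives.\<close>

lemma dual_vertex_separates:
  assumes "n \<ge> 1" "u \<in> coord_space (n - 1)"
    and zero: "\<And>j. j \<in> {1..n} \<Longrightarrow> coord_inner (n - 1) u (dual_vertex n j) = 0"
  shows "u = 0"
proof (rule ccontr)
  let ?K = "Poly_Mapping.keys u"
  assume "u \<noteq> 0"
  \<comment> \<open>Dual vertex \<open>Suc a\<close> combines the functionals \<open>a\<close> and
    \<open>Suc a\<close>, the latter with nonzero factor, so vanishing propagates upwards from the
    zero functional.\<close>
  have coeff_zero: "coord_inner (n - 1) u (coeff_functional (n - 1) a) = 0" if "a < n" for a
    using that
  proof (induction a)
    case 0
    show ?case
      by (simp add: coord_inner_def coeff_functional_def lookup_coord_vec)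
  next
    case (Suc a)
    then show ?case
      using zero[of "Suc a"] by (auto simp: dual_vertex_def linear_diff[OF linear_coord_inner]
          linear_scale[OF linear_coord_inner])
  qed
  define m where "m = Max ?K"
  have m: "m \<in> ?K" "\<And>k. k \<in> ?K \<Longrightarrow> k \<le> m"
    using \<open>u \<noteq> 0\<close> by (auto simp: m_def)
  have md: "m \<in> {1..n - 1}"
    using m assms(2) by (auto simp: coord_space_def)
  have "coord_inner (n - 1) u (coeff_functional (n - 1) m)
      = (\<Sum>k = 1..n - 1. Poly_Mapping.lookup u k * ((-1) ^ (k + m) * real (k choose m)))"
    unfolding coord_inner_def using md
    by (intro sum.cong refl) (auto simp: coeff_functional_def lookup_coord_vec)
  also have "\<dots> = (\<Sum>k\<in>{m}. Poly_Mapping.lookup u k * ((-1) ^ (k + m) * real (k choose m)))"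
  proof (intro sum.mono_neutral_right ballI)
    fix k assume "k \<in> {1..n - 1} - {m}"
    then have "k \<notin> ?K \<or> (k choose m) = 0"
      using m(2)[of k] by (auto simp: binomial_eq_0)
    then show "Poly_Mapping.lookup u k * ((-1) ^ (k + m) * real (k choose m)) = 0"
      by (auto simp: in_keys_iff)
  qed (use md in auto)
  also have "\<dots> \<noteq> 0"
    using m by (auto simp: in_keys_iff)
  finally show False
    using coeff_zero[of m] md by (cases n) auto
qed

section \<open>Integrality and barycentric weights\<close>

lemma shifted_row_in_int_lattice:
  assumes "n \<ge> 1"
  shows "shifted_row n i \<in> int_lattice (n - 1)"
proof -
  have "shifted_row n i \<in> coord_space (n - 1)"
    by (simp add: shifted_row_def trunc_shift_def coord_vec_in_coord_space)
  moreover have "Poly_Mapping.lookup (shifted_row n i) k \<in> \<int>" for k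
    using assms calculation by (cases "k \<in> {1..n - 1}") (auto simp: lookup_shifted_row coord_space_iff)
  ultimately show ?thesis
    by (simp add: int_lattice_def)
qed

text \<open>The inverse change of basis has signed binomials as entries, so integer combinations of
  its functionals stay integral.\<close>

lemma dual_vertex_in_int_lattice: "dual_vertex n j \<in> int_lattice (n - 1)"
proof -
  have "coeff_functional (n - 1) a \<in> coord_space (n - 1)" for a
    by (simp add: coeff_functional_def coord_vec_in_coord_space)
  then have "dual_vertex n j \<in> coord_space (n - 1)"
    by (auto simp: dual_vertex_def intro!: subspace_diff subspace_mul subspace_coord_space)
  moreover have "Poly_Mapping.lookup (coeff_functional (n - 1) a) k \<in> \<int>" for a k
    by (auto simp: coeff_functional_def lookup_coord_vec intro!: Ints_mult Ints_power)
  then have "Poly_Mapping.lookup (dual_vertex n j) k \<in> \<int>" for k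
    by (auto simp: dual_vertex_def lookup_minus lookup_scaleR
        simp del: of_nat_Suc of_nat_add intro!: Ints_diff Ints_mult)
  ultimately show ?thesis
    by (simp add: int_lattice_def)
qed

text \<open>\<open>1/(j(j+1)) = 1/j - 1/(j+1)\<close> telescopes to \<open>1 - 1/n\<close>, and the
  last index contributes the missing \<open>1/n\<close>.\<close>

lemma sum_inverse_dual_scale:
  assumes "n \<ge> 1"
  shows "(\<Sum>j = 1..n. 1 / dual_scale n j) = 1"
proof -
  obtain d where d: "n = Suc d"
    using assms by (cases n) auto
  have "(\<Sum>j = 1..d. 1 / (real j * real (j + 1))) = 1 - 1 / real (d + 1)"
  proof (induction d)
    case (Suc d)
    have "1 / (real (Suc d) * real (Suc d + 1)) = 1 / real (d + 1) - 1 / real (Suc d + 1)"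
      by (simp add: divide_simps)
    with Suc show ?case
      by simp
  qed simp
  moreover have "(\<Sum>j = 1..d. 1 / dual_scale n j) = (\<Sum>j = 1..d. 1 / (real j * real (j + 1)))"
    by (intro sum.cong) (auto simp: dual_scale_def d)
  ultimately show ?thesis
    by (simp add: d dual_scale_def)
qed

text \<open>The map is affine, a linear projection \<open>L\<close> followed by translation by
  \<open>t\<close>, hence commutes with convex hulls.\<close>

lemma trunc_shift_Omega_polytope:
  "trunc_shift n ` Omega_polytope n = convex hull (shifted_row n ` {1..n})"
proof -
  define L where "L p = coord_vec (n - 1) (\<lambda>k. Poly_Mapping.lookup p (k + 1))" for p
  define t where "t = coord_vec (n - 1) (\<lambda>k. - real (n choose (k + 1)))"
  have "linear L"
    by (rule linearI) (auto simp: L_def poly_mapping_eq_iff fun_eq_iff lookup_coord_vec lookup_add lookup_scaleR)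
  have eq: "trunc_shift n p = t + L p" for p
    by (auto simp: L_def t_def trunc_shift_def poly_mapping_eq_iff fun_eq_iff lookup_coord_vec lookup_add)
  have "trunc_shift n ` (convex hull S) = convex hull (trunc_shift n ` S)" for S
  proof -
    have "trunc_shift n ` A = (\<lambda>x. t + x) ` L ` A" for A
      by (simp add: image_image eq)
    then show ?thesis
      by (simp only: convex_hull_linear_image[OF \<open>linear L\<close>] convex_hull_translation)
  qed
  then show ?thesis
    by (simp add: Omega_polytope_def shifted_row_def image_image)
qed

theorem mainTheorem14:
  fixes n :: nat
  assumes "n \<ge> 1"
  shows "reflexive_polytope (n - 1) (trunc_shift n ` Omega_polytope n)"
proof -
  let ?d = "n - 1" and ?W = "convex hull (shifted_row n ` {1..n})"
    and ?Y = "convex hull (dual_vertex n ` {1..n})"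
  have W: "shifted_row n i \<in> coord_space ?d" and Y: "dual_vertex n i \<in> coord_space ?d" for i
    using shifted_row_in_int_lattice[OF assms] dual_vertex_in_int_lattice
    by (auto simp: int_lattice_def)
  have pos: "dual_scale n i > 0" if "i \<in> {1..n}" for i
    using that by (auto simp: dual_scale_def)
  have dual: "dual_polytope ?d ?W = ?Y"
    using assms W Y pos sum_inverse_dual_scale coord_inner_shifted_row_dual_vertex
      shifted_row_separates dual_vertex_separates
    by (intro dual_polytope_simplex[where c = "dual_scale n"]) auto
  \<comment> \<open>The pairing matrix is symmetric, so the simplex criterion applies again with the
    two vertex families exchanged.\<close>
  have bidual: "dual_polytope ?d ?Y = ?W"
  proof (rule dual_polytope_simplex[where c = "dual_scale n"])
    show "coord_inner ?d (dual_vertex n i) (shifted_row n j) = (if i = j then dual_scale n i else 0) - 1"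
      if "i \<in> {1..n}" "j \<in> {1..n}" for i j
      using coord_inner_shifted_row_dual_vertex[OF that(2,1)]
      by (subst coord_inner_commute) auto
    show "u = 0" if "u \<in> coord_space ?d"
      "\<And>i. i \<in> {1..n} \<Longrightarrow> coord_inner ?d (dual_vertex n i) u = 0" for u
      using dual_vertex_separates[OF assms that(1)] that(2) by (simp only: coord_inner_commute[of ?d u])
    show "u = 0" if "u \<in> coord_space ?d"
      "\<And>i. i \<in> {1..n} \<Longrightarrow> coord_inner ?d u (shifted_row n i) = 0" for u
      using shifted_row_separates[OF assms that(1)] that(2) by (simp only: coord_inner_commute[of ?d _ u])
  qed (use W Y pos sum_inverse_dual_scale[OF assms] in auto)
  have "lattice_polytope ?d ?W" "lattice_polytope ?d ?Y"
    using shifted_row_in_int_lattice[OF assms] dual_vertex_in_int_lattice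
    by (auto intro!: lattice_polytope_convex_hull)
  \<comment> \<open>Biduality presents the simplex as a dual, so the origin is interior without any
    explicit neighbourhood.\<close>
  moreover have "0 \<in> top_of_set (coord_space ?d) interior_of ?W"
    unfolding bidual[symmetric] by (rule zero_in_interior_dual_polytope) simp
  ultimately show ?thesis
    unfolding reflexive_polytope_def trunc_shift_Omega_polytope dual by blast
qed

end
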